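(* Let $f_1,f_2:\mathbb{R}^d\to\mathbb{R}$ be continuous, $x_0\in\mathbb{R}^d$, $\bar\Delta>0$, and for $i\in\{1,2\}$ let $\{\widetilde f_{i,\Delta}\}_{\Delta\in(0,\bar\Delta]}$ be a class of models of $f_i$. Assume $f_2(x)\ne0$ and $\widetilde f_{2,\Delta}(x)\ne0$ for all $\Delta\in(0,\bar\Delta]$ and $x\in B_\Delta(x_0)$, and put $F=f_1/f_2$, $\widetilde F_\Delta=\widetilde f_{1,\Delta}/\widetilde f_{2,\Delta}$. Suppose that for $i\in\{1,2\}$ the class $\{\widetilde f_{i,\Delta}\}_{(0,\bar\Delta]}$ provides order-$N_i^f$ function accuracy of $f_i$ at (respectively near) $x_0$ with constant $\kappa_i^f(x_0)$, where $N_1^f\ge0$ and $N_2^f>0$. Assume $\bar\Delta$ is small enough that $\bar\Delta^{N_2^f}M_{\frac1{f_2}}(x_0)\kappa_2^f(x_0)<1$, and put $$\widetilde M_{\frac1{\widetilde f_2}}(x_0)=\frac{M_{\frac1{f_2}}(x_0)}{1-\bar\Delta^{N_2^f}M_{\frac1{f_2}}(x_0)\kappa_2^f(x_0)}.$$ Let $N_F^f=\min\{N_1^f,N_2^f\}$ and $$\begin{aligned}K_F^f(x_0)=\min\Big\{&M_{\frac1{f_2}}(x_0)\kappa_1^f(x_0)\bar\Delta^{N_1^f-N_F^f}+M_{\frac1{f_2}}(x_0)\widetilde M_{\frac1{\widetilde f_2}}(x_0)M_{\widetilde f_1}(x_0)\kappa_2^f(x_0)\bar\Delta^{N_2^f-N_F^f},\\&\widetilde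 M_{\frac1{\widetilde f_2}}(x_0)\kappa_1^f(x_0)\bar\Delta^{N_1^f-N_F^f}+M_{\frac1{f_2}}(x_0)\widetilde M_{\frac1{\widetilde f_2}}(x_0)M_{f_1}(x_0)\kappa_2^f(x_0)\bar\Delta^{N_2^f-N_F^f}\Big\}.\end{aligned}$$ Then for every $\Delta\in(0,\bar\Delta]$: (i) if the accuracy provided is at $x_0$, then $|F(x_0)-\widetilde F_\Delta(x_0)|\le K_F^f(x_0)\Delta^{N_F^f}$; (ii) if the accuracy provided is near $x_0$, then $|F(x)-\widetilde F_\Delta(x)|\le K_F^f(x_0)\Delta^{N_F^f}$ for all $x\in B_\Delta(x_0)$. In particular, $\{\widetilde F_\Delta\}_{(0,\bar\Delta]}$ provides order-$N_F^f$ function accuracy of $F$ at (respectively near) $x_0$.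
   Context: $B_\Delta(x_0)$ is the closed ball of radius $\Delta$ centered at $x_0$. A class of models of $f:\mathbb{R}^d\to\mathbb{R}$ is a family of functions $\widetilde f_\Delta:\mathbb{R}^d\to\mathbb{R}$ indexed by $\Delta\in(0,\bar\Delta]$. For real $N\ge0$ and $\kappa\ge0$, it provides order-$N$ function accuracy of $f$ at $x_0$ with constant $\kappa$ if $|f(x_0)-\widetilde f_\Delta(x_0)|\le\kappa\Delta^N$ for all $\Delta\in(0,\bar\Delta]$; near $x_0$ with constant $\kappa$ if $|f(x)-\widetilde f_\Delta(x)|\le\kappa\Delta^N$ for all $\Delta\in(0,\bar\Delta]$ and $x\in B_\Delta(x_0)$. Without mention of a constant, it is meant that some such $\kappa\ge0$ exists. Bounds: $M_{f_1}(x_0)$ and $M_{\frac1{f_2}}(x_0)$ denote numbers with $|f_1(x)|\le M_{f_1}(x_0)$ and $|1/f_2(x)|\le M_{\frac1{f_2}}(x_0)$ for all $x\in B_{\bar\Delta}(x_0)$. $M_{\widetilde f_1}(x_0)$ denotes a uniform bound for the models of $f_1$: $|\widetilde f_{1,\Delta}(x_0)|\le M_{\widetilde f_1}(x_0)$ for all $\Delta\in(0,\bar\Delta]$ in the "at $x_0$" case, and $|\widetilde f_{1,\Delta}(x)|\le M_{\widetilde f_1}(x_0)$ for all $\Delta\in(0,\bar\Delta]$, $x\in B_\Delta(x_0)$ in the "near $x_0$" case (it exists; one may take $\bar\Delta^{N_1^f}\kappa_1^f(x_0)+M_{f_1}(x_0)$). The quotients $F,\widetilde F_\Delta$ are considered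 where the denominators are nonzero. *)

theory Defs
  imports "HOL-Analysis.Analysis"
begin

(* A class of models is a function of the radius r and the point x; only its values
   for r in the interval (0, R] are ever used.  The order N is real, so powers are
   written with powr; their bases r and R are always positive. *)

definition fun_accuracy_at_const ::
  "real \<Rightarrow> (real \<Rightarrow> real ^ 'd \<Rightarrow> real) \<Rightarrow> (real ^ 'd \<Rightarrow> real) \<Rightarrow> real ^ 'd \<Rightarrow> real \<Rightarrow> real \<Rightarrow> bool"
where
  "fun_accuracy_at_const R m f x0 N \<kappa> \<longleftrightarrow>
     (\<forall>r\<in>{0<..R}. \<bar>f x0 - m r x0\<bar> \<le> \<kappa> * r powr N)"

definition fun_accuracy_near_const ::
  "real \<Rightarrow> (real \<Rightarrow> real ^ 'd \<Rightarrow> real) \<Rightarrow> (real ^ 'd \<Rightarrow> real) \<Rightarrow> real ^ 'd \<Rightarrow> real \<Rightarrow> real \<Rightarrow> bool"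
where
  "fun_accuracy_near_const R m f x0 N \<kappa> \<longleftrightarrow>
     (\<forall>r\<in>{0<..R}. \<forall>x\<in>cball x0 r. \<bar>f x - m r x\<bar> \<le> \<kappa> * r powr N)"

definition fun_accuracy_at ::
  "real \<Rightarrow> (real \<Rightarrow> real ^ 'd \<Rightarrow> real) \<Rightarrow> (real ^ 'd \<Rightarrow> real) \<Rightarrow> real ^ 'd \<Rightarrow> real \<Rightarrow> bool"
where
  "fun_accuracy_at R m f x0 N \<longleftrightarrow> (\<exists>\<kappa>\<ge>0. fun_accuracy_at_const R m f x0 N \<kappa>)"

definition fun_accuracy_near ::
  "real \<Rightarrow> (real \<Rightarrow> real ^ 'd \<Rightarrow> real) \<Rightarrow> (real ^ 'd \<Rightarrow> real) \<Rightarrow> real ^ 'd \<Rightarrow> real \<Rightarrow> bool"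
where
  "fun_accuracy_near R m f x0 N \<longleftrightarrow> (\<exists>\<kappa>\<ge>0. fun_accuracy_near_const R m f x0 N \<kappa>)"

(* Mi2 bounds 1/f2 on the ball of radius R; the value bounds the reciprocals of the
   models of f2, and is meant for R powr N2 * Mi2 * k2 < 1. *)
definition recip_model_bound :: "real \<Rightarrow> real \<Rightarrow> real \<Rightarrow> real \<Rightarrow> real"
where
  "recip_model_bound R N2 Mi2 \<kappa>2 = Mi2 / (1 - R powr N2 * Mi2 * \<kappa>2)"

(* M1 bounds f1, Mt1 bounds the models of f1, and Mi2 bounds 1/f2. *)
definition quotient_const ::
  "real \<Rightarrow> real \<Rightarrow> real \<Rightarrow> real \<Rightarrow> real \<Rightarrow> real \<Rightarrow> real \<Rightarrow> real \<Rightarrow> real"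
where
  "quotient_const R N1 N2 \<kappa>1 \<kappa>2 M1 Mt1 Mi2 =
     (let N = min N1 N2; Mti2 = recip_model_bound R N2 Mi2 \<kappa>2 in
      min (Mi2 * \<kappa>1 * R powr (N1 - N) + Mi2 * Mti2 * Mt1 * \<kappa>2 * R powr (N2 - N))
          (Mti2 * \<kappa>1 * R powr (N1 - N) + Mi2 * Mti2 * M1 * \<kappa>2 * R powr (N2 - N)))"

end

theory Submission
  imports Defs
begin

text \<open>Both terms of the minimum come from
  \<open>a / b - a' / b' = (a - a') / b + a' (b' - b) / (b b')\<close>, once as it stands and once with the
  exact and the model values exchanged. Since \<open>1 / \<bar>b\<bar> \<le> Mi2\<close>, the model denominator satisfies
  \<open>1 - R powr N2 * Mi2 * \<kappa>2 \<le> Mi2 * \<bar>b'\<bar>\<close>, which bounds \<open>1 / b'\<close>.\<close>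

lemma abs_quotient_diff_le:
  fixes a b a' b' A B C D E :: real
  assumes "b \<noteq> 0" "b' \<noteq> 0"
    and "\<bar>a - a'\<bar> \<le> A" "\<bar>b - b'\<bar> \<le> B" "\<bar>1 / b\<bar> \<le> C" "\<bar>1 / b'\<bar> \<le> D" "\<bar>a'\<bar> \<le> E"
  shows "\<bar>a / b - a' / b'\<bar> \<le> C * A + C * D * E * B"
proof -
  have "a / b - a' / b' = 1 / b * (a - a') + 1 / b * (1 / b') * a' * (b' - b)"
    using assms(1,2) by (simp add: field_simps)
  also have "\<bar>\<dots>\<bar> \<le> \<bar>1 / b\<bar> * \<bar>a - a'\<bar> + \<bar>1 / b\<bar> * \<bar>1 / b'\<bar> * \<bar>a'\<bar> * \<bar>b - b'\<bar>"
    by (rule order_trans[OF abs_triangle_ineq]) (simp add: abs_mult abs_minus_commute)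
  also have "\<dots> \<le> C * A + C * D * E * B"
    \<comment> \<open>Nonnegativity of \<open>C\<close>, \<open>D\<close> and \<open>E\<close> is
      not assumed: each dominates an absolute value, so it follows by transitivity.\<close>
    using assms(3-7) by (intro add_mono mult_mono mult_nonneg_nonneg abs_ge_zero order_trans[OF abs_ge_zero])
  finally show ?thesis .
qed

lemma abs_recip_le_recip_model_bound:
  fixes b b' :: real
  assumes "b \<noteq> 0" "b' \<noteq> 0" and b: "\<bar>1 / b\<bar> \<le> Mi2" and d: "\<bar>b - b'\<bar> \<le> \<kappa>2 * R powr N2"
    and small: "R powr N2 * Mi2 * \<kappa>2 < 1"
  shows "\<bar>1 / b'\<bar> \<le> recip_model_bound R N2 Mi2 \<kappa>2"
proof -
  have "0 \<le> Mi2"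
    using b by linarith
  have "1 \<le> Mi2 * \<bar>b\<bar>"
    using b \<open>b \<noteq> 0\<close> by (simp add: field_simps)
  \<comment> \<open>Triangle inequality in the form
    \<open>\<bar>b\<bar> \<le> \<bar>b'\<bar> + \<bar>b - b'\<bar>\<close>.\<close>
  also have "\<dots> \<le> Mi2 * (\<bar>b'\<bar> + \<kappa>2 * R powr N2)"
    using d by (intro mult_left_mono \<open>0 \<le> Mi2\<close>) linarith
  finally have "1 - R powr N2 * Mi2 * \<kappa>2 \<le> Mi2 * \<bar>b'\<bar>"
    by (simp add: algebra_simps)
  then show ?thesis
    \<comment> \<open>By \<open>small\<close> the left-hand side of the last inequality is positive,
      so dividing by it and by \<open>\<bar>b'\<bar>\<close> keeps the direction.\<close>
    using \<open>b' \<noteq> 0\<close> small unfolding recip_model_bound_def by (simp add: field_simps)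
qed

text \<open>Split off \<open>r powr N\<close> and enlarge only the remaining factor, whose exponent
  \<open>N' - N\<close> is nonnegative. This produces the powers of \<open>R\<close> in
  \<open>quotient_const\<close> when the two orders are reduced to their minimum.\<close>

lemma mult_powr_le_mult_powr_diff:
  fixes r R N N' k :: real
  assumes "0 < r" "r \<le> R" "N \<le> N'" "0 \<le> k"
  shows "k * r powr N' \<le> k * R powr (N' - N) * r powr N"
proof -
  have "r powr N' = r powr (N' - N) * r powr N"
    by (simp flip: powr_add)
  also have "\<dots> \<le> R powr (N' - N) * r powr N"
    using assms by (intro mult_right_mono powr_mono2) auto
  finally show ?thesis
    using \<open>0 \<le> k\<close> by (simp add: mult_left_mono mult.assoc)
qed

text \<open>The estimate at a single point, phrased for plain numbers so that it serves the accuracy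
  at \<open>x0\<close> and near \<open>x0\<close> alike.\<close>

lemma abs_quotient_diff_le_quotient_const:
  fixes a b a' b' :: real
  assumes r: "0 < r" "r \<le> R" and "0 \<le> N2" "0 \<le> \<kappa>1" "0 \<le> \<kappa>2"
    and nz: "b \<noteq> 0" "b' \<noteq> 0"
    and a: "\<bar>a - a'\<bar> \<le> \<kappa>1 * r powr N1" and b: "\<bar>b - b'\<bar> \<le> \<kappa>2 * r powr N2"
    and M: "\<bar>a\<bar> \<le> M1" "\<bar>a'\<bar> \<le> Mt1" "\<bar>1 / b\<bar> \<le> Mi2"
    and small: "R powr N2 * Mi2 * \<kappa>2 < 1"
  shows "\<bar>a / b - a' / b'\<bar> \<le> quotient_const R N1 N2 \<kappa>1 \<kappa>2 M1 Mt1 Mi2 * r powr min N1 N2"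
proof -
  define N where "N = min N1 N2"
  let ?D = "recip_model_bound R N2 Mi2 \<kappa>2"
  let ?A = "\<kappa>1 * R powr (N1 - N) * r powr N" and ?B = "\<kappa>2 * R powr (N2 - N) * r powr N"
  \<comment> \<open>Replacing \<open>r\<close> by \<open>R\<close> makes the bound on
    \<open>1 / b'\<close> independent of the radius.\<close>
  have "\<kappa>2 * r powr N2 \<le> \<kappa>2 * R powr N2"
    using assms by (intro mult_left_mono powr_mono2) auto
  then have D: "\<bar>1 / b'\<bar> \<le> ?D"
    using b by (intro abs_recip_le_recip_model_bound[OF nz M(3) _ small]) linarith
  have A: "\<bar>a - a'\<bar> \<le> ?A"
    using a mult_powr_le_mult_powr_diff[OF r, of N N1 \<kappa>1] \<open>0 \<le> \<kappa>1\<close> by (simp add: N_def)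
  have B: "\<bar>b - b'\<bar> \<le> ?B"
    using b mult_powr_le_mult_powr_diff[OF r, of N N2 \<kappa>2] \<open>0 \<le> \<kappa>2\<close> by (simp add: N_def)
  have 1: "\<bar>a / b - a' / b'\<bar> \<le> Mi2 * ?A + Mi2 * ?D * Mt1 * ?B"
    by (intro abs_quotient_diff_le nz A B D M)
  \<comment> \<open>Exact and model values trade places: \<open>?D\<close> now multiplies the
    numerator error, and the bound \<open>M1\<close> of the exact numerator takes the place of
    \<open>Mt1\<close>.\<close>
  have "\<bar>a' / b' - a / b\<bar> \<le> ?D * ?A + ?D * Mi2 * M1 * ?B"
    using A B by (intro abs_quotient_diff_le nz D M) (simp_all add: abs_minus_commute)
  then have 2: "\<bar>a / b - a' / b'\<bar> \<le> ?D * ?A + ?D * Mi2 * M1 * ?B"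
    by (simp add: abs_minus_commute)
  from 1 2 show ?thesis
    unfolding quotient_const_def Let_def N_def[symmetric]
    by (simp add: min_def algebra_simps)
qed

text \<open>Supplies an explicit \<open>Mt1\<close>, uniform in the radius, for the claims that only
  assert the existence of an accuracy constant.\<close>

lemma abs_model_le:
  fixes a a' :: real
  assumes "0 < r" "r \<le> R" "0 \<le> N" "0 \<le> \<kappa>" "\<bar>a - a'\<bar> \<le> \<kappa> * r powr N" "\<bar>a\<bar> \<le> M"
  shows "\<bar>a'\<bar> \<le> R powr N * \<kappa> + M"
proof -
  have "\<kappa> * r powr N \<le> \<kappa> * R powr N"
    using assms by (intro mult_left_mono powr_mono2) auto
  then show ?thesis
    using assms by (simp add: mult.commute)
qed

theorem theorem22:
  fixes f1 f2 :: "real ^ 'd \<Rightarrow> real"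
    and m1 m2 :: "real \<Rightarrow> real ^ 'd \<Rightarrow> real"
    and x0 :: "real ^ 'd"
    and R N1 N2 \<kappa>1 \<kappa>2 M1 Mi2 :: real
  assumes "continuous_on UNIV f1" and "continuous_on UNIV f2"
    and "R > 0"
    and "\<And>r x. r \<in> {0<..R} \<Longrightarrow> x \<in> cball x0 r \<Longrightarrow> f2 x \<noteq> 0 \<and> m2 r x \<noteq> 0"
    and "N1 \<ge> 0" and "N2 > 0"
    and "\<kappa>1 \<ge> 0" and "\<kappa>2 \<ge> 0"
    and "\<And>x. x \<in> cball x0 R \<Longrightarrow> \<bar>f1 x\<bar> \<le> M1"
    and "\<And>x. x \<in> cball x0 R \<Longrightarrow> \<bar>1 / f2 x\<bar> \<le> Mi2"
    and "R powr N2 * Mi2 * \<kappa>2 < 1"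
  shows
    "(fun_accuracy_at_const R m1 f1 x0 N1 \<kappa>1 \<and> fun_accuracy_at_const R m2 f2 x0 N2 \<kappa>2 \<longrightarrow>
       (\<forall>Mt1. (\<forall>r\<in>{0<..R}. \<bar>m1 r x0\<bar> \<le> Mt1) \<longrightarrow>
          (\<forall>r\<in>{0<..R}. \<bar>f1 x0 / f2 x0 - m1 r x0 / m2 r x0\<bar>
             \<le> quotient_const R N1 N2 \<kappa>1 \<kappa>2 M1 Mt1 Mi2 * r powr min N1 N2)) \<and>
       fun_accuracy_at R (\<lambda>r x. m1 r x / m2 r x) (\<lambda>x. f1 x / f2 x) x0 (min N1 N2))
     \<and>
     (fun_accuracy_near_const R m1 f1 x0 N1 \<kappa>1 \<and> fun_accuracy_near_const R m2 f2 x0 N2 \<kappa>2 \<longrightarrow>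
       (\<forall>Mt1. (\<forall>r\<in>{0<..R}. \<forall>x\<in>cball x0 r. \<bar>m1 r x\<bar> \<le> Mt1) \<longrightarrow>
          (\<forall>r\<in>{0<..R}. \<forall>x\<in>cball x0 r. \<bar>f1 x / f2 x - m1 r x / m2 r x\<bar>
             \<le> quotient_const R N1 N2 \<kappa>1 \<kappa>2 M1 Mt1 Mi2 * r powr min N1 N2)) \<and>
       fun_accuracy_near R (\<lambda>r x. m1 r x / m2 r x) (\<lambda>x. f1 x / f2 x) x0 (min N1 N2))"
proof -
  let ?K = "\<lambda>Mt1. quotient_const R N1 N2 \<kappa>1 \<kappa>2 M1 Mt1 Mi2"
  \<comment> \<open>Since \<open>r \<le> R\<close>, the point \<open>x\<close> also lies in
    \<open>cball x0 R\<close>, where \<open>M1\<close> and \<open>Mi2\<close> are valid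
    bounds.\<close>
  have bound: "\<bar>f1 x / f2 x - m1 r x / m2 r x\<bar> \<le> ?K Mt1 * r powr min N1 N2"
    if "r \<in> {0<..R}" "x \<in> cball x0 r" "\<bar>f1 x - m1 r x\<bar> \<le> \<kappa>1 * r powr N1"
      "\<bar>f2 x - m2 r x\<bar> \<le> \<kappa>2 * r powr N2" "\<bar>m1 r x\<bar> \<le> Mt1" for r x Mt1
    using that assms(4)[OF that(1,2)] assms(6-8,11) assms(9,10)[of x]
    by (intro abs_quotient_diff_le_quotient_const) auto
  have model: "\<bar>m1 r x\<bar> \<le> R powr N1 * \<kappa>1 + M1"
    if "r \<in> {0<..R}" "x \<in> cball x0 r" "\<bar>f1 x - m1 r x\<bar> \<le> \<kappa>1 * r powr N1" for r x
    using that assms(5,7) assms(9)[of x] by (intro abs_model_le[of r]) auto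
  let ?M = "R powr N1 * \<kappa>1 + M1"
  \<comment> \<open>Accuracy demands a nonnegative constant; the absolute value provides one without
    a discussion of the sign of \<open>quotient_const\<close>.\<close>
  have abs_K: "z \<le> \<bar>?K ?M\<bar> * r powr min N1 N2" if "z \<le> ?K ?M * r powr min N1 N2" for z r :: real
    using that by (rule order_trans) (intro mult_right_mono abs_ge_self powr_ge_zero)
  have centre: "x0 \<in> cball x0 r" if "r \<in> {0<..R}" for r
    using that by simp
  have at: "fun_accuracy_at R (\<lambda>r x. m1 r x / m2 r x) (\<lambda>x. f1 x / f2 x) x0 (min N1 N2)"
    if "fun_accuracy_at_const R m1 f1 x0 N1 \<kappa>1" "fun_accuracy_at_const R m2 f2 x0 N2 \<kappa>2"
    unfolding fun_accuracy_at_def fun_accuracy_at_const_def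
    using that[unfolded fun_accuracy_at_const_def]
    by (intro exI[of _ "\<bar>?K ?M\<bar>"] conjI ballI abs_ge_zero abs_K bound model centre) auto
  have near: "fun_accuracy_near R (\<lambda>r x. m1 r x / m2 r x) (\<lambda>x. f1 x / f2 x) x0 (min N1 N2)"
    if "fun_accuracy_near_const R m1 f1 x0 N1 \<kappa>1" "fun_accuracy_near_const R m2 f2 x0 N2 \<kappa>2"
    unfolding fun_accuracy_near_def fun_accuracy_near_const_def
    using that[unfolded fun_accuracy_near_const_def]
    by (intro exI[of _ "\<bar>?K ?M\<bar>"] conjI ballI abs_ge_zero abs_K bound model) auto
  show ?thesis
  \<comment> \<open>The rules \<open>at\<close> and \<open>near\<close> settle the two accuracy
    claims; the explicit bounds for arbitrary \<open>Mt1\<close> remain.\<close>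
  proof (intro conjI impI allI ballI at near; (elim conjE)?)
    fix Mt1 r
    assume "\<forall>r\<in>{0<..R}. \<bar>m1 r x0\<bar> \<le> Mt1" "r \<in> {0<..R}"
      "fun_accuracy_at_const R m1 f1 x0 N1 \<kappa>1" "fun_accuracy_at_const R m2 f2 x0 N2 \<kappa>2"
    then show "\<bar>f1 x0 / f2 x0 - m1 r x0 / m2 r x0\<bar> \<le> ?K Mt1 * r powr min N1 N2"
      unfolding fun_accuracy_at_const_def by (intro bound centre) auto
  next
    fix Mt1 r x
    assume "\<forall>r\<in>{0<..R}. \<forall>x\<in>cball x0 r. \<bar>m1 r x\<bar> \<le> Mt1" "r \<in> {0<..R}" "x \<in> cball x0 r"
      "fun_accuracy_near_const R m1 f1 x0 N1 \<kappa>1" "fun_accuracy_near_const R m2 f2 x0 N2 \<kappa>2"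
    then show "\<bar>f1 x / f2 x - m1 r x / m2 r x\<bar> \<le> ?K Mt1 * r powr min N1 N2"
      unfolding fun_accuracy_near_const_def by (intro bound) auto
  qed
qed

end
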